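(* Let $M$ be a non-degenerate Orlicz function satisfying the $\Delta_2$ condition at zero, and let $f:\ell_M\to\mathbb{R}\cup\{+\infty\}$ be a proper, lower semicontinuous and bounded below function with bounded domain $\mathrm{dom}\,f=\{x\in\ell_M: f(x)<+\infty\}$. Then for any $0<\delta<\varepsilon$ there is $a\in\ell_\infty$ such that $\delta\le a_n\le\varepsilon$ for all $n\in\mathbb{N}$ and the function $f-g_a$ attains its minimum on $\ell_M$, where $g_a(x)=\sum_{n=1}^\infty a_nM(|x_n|)$ for $x=(x_n)_{n\ge1}\in\ell_M$.
   Context: An Orlicz function is a continuous, non-decreasing, convex function $M:[0,\infty)\to[0,\infty)$ with $M(0)=0$ and $\lim_{t\to\infty}M(t)=\infty$. It is degenerate if $M(t)=0$ for some $t>0$, and non-degenerate otherwise. A non-degenerate $M$ satisfies the $\Delta_2$ condition at zero if $\liminf_{t\downarrow0}M(t)/M(2t)>0$. $\ell_\infty$ is the space of bounded real sequences with $\|a\|_\infty=\sup_n|a_n|$. For $x\in\ell_\infty$ put $\sigma_M(x)=\sum_{n=1}^\infty M(|x_n|)\in[0,\infty]$. The Orlicz sequence space $\ell_M$ is the linear space of all $x\in\ell_\infty$ with $\sigma_M(x/\rho)<\infty$ for some $\rho>0$, equipped with the norm $\|x\|=\inf\{\rho>0:\sigma_M(x/\rho)\le1\}$; it is a Banach space. When $M$ is non-degenerate and satisfies $\Delta_2$ at zero, $\sigma_M$ is finite on $\ell_M$ and, for $a\in\ell_\infty$, the series defining $g_a(x)$ converges absolutely for every $x\in\ell_M$. A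 function $f$ with values in $\mathbb{R}\cup\{+\infty\}$ is proper if it is finite at some point. *)

theory Defs
  imports "HOL-Analysis.Analysis"
begin

text \<open>
  An Orlicz function \<open>M : [0,\<infinity>) \<rightarrow> [0,\<infinity>)\<close> is given as a function on all reals of which only the
  restriction to \<open>{0..}\<close> matters. Sequences \<open>(x\<^sub>n)\<^sub>n\<^sub>\<ge>\<^sub>1\<close> are functions on \<open>nat\<close>, indexed from 0.
\<close>

definition orlicz_function :: "(real \<Rightarrow> real) \<Rightarrow> bool" where
  "orlicz_function M \<longleftrightarrow>
     continuous_on {0..} M \<and> mono_on {0..} M \<and> convex_on {0..} M \<and>
     (\<forall>t\<ge>0. 0 \<le> M t) \<and> M 0 = 0 \<and> filterlim M at_top at_top"

definition degenerate :: "(real \<Rightarrow> real) \<Rightarrow> bool" where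
  "degenerate M \<longleftrightarrow> (\<exists>t>0. M t = 0)"

definition Delta2_at_zero :: "(real \<Rightarrow> real) \<Rightarrow> bool" where
  "Delta2_at_zero M \<longleftrightarrow> 0 < Liminf (at_right 0) (\<lambda>t. ereal (M t / M (2 * t)))"

definition linfty :: "(nat \<Rightarrow> real) set" where
  "linfty = {x. bounded (range x)}"

definition orlicz_modular :: "(real \<Rightarrow> real) \<Rightarrow> (nat \<Rightarrow> real) \<Rightarrow> ennreal" where
  "orlicz_modular M x = (\<Sum>n. ennreal (M \<bar>x n\<bar>))"

definition orlicz_space :: "(real \<Rightarrow> real) \<Rightarrow> (nat \<Rightarrow> real) set" where
  "orlicz_space M = {x \<in> linfty. \<exists>\<rho>>0. orlicz_modular M (\<lambda>n. x n / \<rho>) < \<infinity>}"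

definition orlicz_norm :: "(real \<Rightarrow> real) \<Rightarrow> (nat \<Rightarrow> real) \<Rightarrow> real" where
  "orlicz_norm M x = Inf {\<rho>. 0 < \<rho> \<and> orlicz_modular M (\<lambda>n. x n / \<rho>) \<le> 1}"

text \<open>
  The norm distance. The locale \<open>Metric_space\<close> wants it non-negative also off the carrier, where
  the infimum may be the unspecified \<open>Inf {}\<close>; hence the value 0 there.
\<close>

definition orlicz_dist :: "(real \<Rightarrow> real) \<Rightarrow> (nat \<Rightarrow> real) \<Rightarrow> (nat \<Rightarrow> real) \<Rightarrow> real" where
  "orlicz_dist M x y =
     (if x \<in> orlicz_space M \<and> y \<in> orlicz_space M then orlicz_norm M (\<lambda>n. x n - y n) else 0)"

text \<open>The norm topology of \<open>\<ell>\<^sub>M\<close>; that \<open>orlicz_dist\<close> is a metric is proved below.\<close>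

definition orlicz_topology :: "(real \<Rightarrow> real) \<Rightarrow> (nat \<Rightarrow> real) topology" where
  "orlicz_topology M = Metric_space.mtopology (orlicz_space M) (orlicz_dist M)"

definition lower_semicontinuous_map :: "'a topology \<Rightarrow> ('a \<Rightarrow> ereal) \<Rightarrow> bool" where
  "lower_semicontinuous_map X f \<longleftrightarrow> (\<forall>c. openin X {x \<in> topspace X. c < f x})"

text \<open>A real series: under non-degeneracy and \<open>\<Delta>\<^sub>2\<close> it converges absolutely for \<open>a \<in> \<ell>\<^sub>\<infinity>\<close>, \<open>x \<in> \<ell>\<^sub>M\<close>.\<close>

definition weighted_modular :: "(real \<Rightarrow> real) \<Rightarrow> (nat \<Rightarrow> real) \<Rightarrow> (nat \<Rightarrow> real) \<Rightarrow> real" where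
  "weighted_modular M a x = (\<Sum>n. a n * M \<bar>x n\<bar>)"

definition attains_min_on :: "('a \<Rightarrow> 'b::linorder) \<Rightarrow> 'a set \<Rightarrow> bool" where
  "attains_min_on h S \<longleftrightarrow> (\<exists>x\<in>S. \<forall>y\<in>S. h x \<le> h y)"


context
  fixes M :: "real \<Rightarrow> real"
  assumes M: "orlicz_function M"
begin

lemma orlicz_function_convex_comb:
  assumes "0 \<le> s" "0 \<le> t" "0 \<le> u" "0 \<le> v" "u + v = 1"
  shows "M (u * s + v * t) \<le> u * M s + v * M t"
proof -
  have "convex_on {0..} M" using M by (simp add: orlicz_function_def)
  from convex_onD[OF this, of v s t] have "M ((1 - v) * s + v * t) \<le> (1 - v) * M s + v * M t"
    using assms by auto
  moreover have "u = 1 - v" using assms by simp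
  ultimately show ?thesis by simp
qed

lemma orlicz_modular_add_le_1:
  assumes "0 < \<rho>" "0 < \<tau>"
    and x: "orlicz_modular M (\<lambda>n. x n / \<rho>) \<le> 1" and y: "orlicz_modular M (\<lambda>n. y n / \<tau>) \<le> 1"
  shows "orlicz_modular M (\<lambda>n. (x n + y n) / (\<rho> + \<tau>)) \<le> 1"
proof -
  define u v where "u = \<rho> / (\<rho> + \<tau>)" and "v = \<tau> / (\<rho> + \<tau>)"
  have uv: "0 \<le> u" "0 \<le> v" "u + v = 1"
    using assms by (auto simp: u_def v_def simp flip: add_divide_distrib)
  have nn: "0 \<le> M \<bar>t\<bar>" for t using M by (simp add: orlicz_function_def)
  have pt: "ennreal (M \<bar>(x n + y n) / (\<rho> + \<tau>)\<bar>)
      \<le> ennreal u * ennreal (M \<bar>x n / \<rho>\<bar>) + ennreal v * ennreal (M \<bar>y n / \<tau>\<bar>)" for n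
  proof -
    have "(x n + y n) / (\<rho> + \<tau>) = u * (x n / \<rho>) + v * (y n / \<tau>)"
      using assms by (simp add: u_def v_def add_divide_distrib)
    then have "\<bar>(x n + y n) / (\<rho> + \<tau>)\<bar> \<le> u * \<bar>x n / \<rho>\<bar> + v * \<bar>y n / \<tau>\<bar>"
      using uv by (metis abs_mult abs_of_nonneg abs_triangle_ineq)
    moreover have "mono_on {0..} M" using M by (simp add: orlicz_function_def)
    ultimately have "M \<bar>(x n + y n) / (\<rho> + \<tau>)\<bar> \<le> M (u * \<bar>x n / \<rho>\<bar> + v * \<bar>y n / \<tau>\<bar>)"
      using uv by (auto intro!: mono_onD[of "{0..}" M])
    also have "\<dots> \<le> u * M \<bar>x n / \<rho>\<bar> + v * M \<bar>y n / \<tau>\<bar>"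
      using uv by (intro orlicz_function_convex_comb) auto
    finally have "ennreal (M \<bar>(x n + y n) / (\<rho> + \<tau>)\<bar>)
        \<le> ennreal (u * M \<bar>x n / \<rho>\<bar> + v * M \<bar>y n / \<tau>\<bar>)"
      by (rule ennreal_leI)
    also have "\<dots> = ennreal u * ennreal (M \<bar>x n / \<rho>\<bar>) + ennreal v * ennreal (M \<bar>y n / \<tau>\<bar>)"
      using uv(1,2) nn[of "x n / \<rho>"] nn[of "y n / \<tau>"]
      by (simp only: ennreal_plus ennreal_mult mult_nonneg_nonneg)
    finally show ?thesis .
  qed
  have "orlicz_modular M (\<lambda>n. (x n + y n) / (\<rho> + \<tau>))
      \<le> (\<Sum>n. ennreal u * ennreal (M \<bar>x n / \<rho>\<bar>) + ennreal v * ennreal (M \<bar>y n / \<tau>\<bar>))"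
    unfolding orlicz_modular_def by (rule suminf_le[OF pt]) auto
  also have "\<dots> = ennreal u * orlicz_modular M (\<lambda>n. x n / \<rho>)
      + ennreal v * orlicz_modular M (\<lambda>n. y n / \<tau>)"
    unfolding orlicz_modular_def by (subst suminf_add[symmetric]) auto
  also have "\<dots> \<le> ennreal u * 1 + ennreal v * 1"
    by (intro add_mono mult_left_mono x y) auto
  also have "\<dots> = 1" using uv by (simp flip: ennreal_plus)
  finally show ?thesis .
qed

lemma orlicz_space_obtain_le_1:
  assumes "x \<in> orlicz_space M"
  obtains \<rho> where "0 < \<rho>" "orlicz_modular M (\<lambda>n. x n / \<rho>) \<le> 1"
proof -
  obtain \<rho> where \<rho>: "0 < \<rho>" "orlicz_modular M (\<lambda>n. x n / \<rho>) < \<infinity>"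
    using assms by (auto simp: orlicz_space_def)
  then obtain K where K: "0 \<le> K" "orlicz_modular M (\<lambda>n. x n / \<rho>) = ennreal K"
    by (cases "orlicz_modular M (\<lambda>n. x n / \<rho>)") auto
  define u where "u = 1 / max 1 K"
  have u: "0 < u" "u \<le> 1" "u * K \<le> 1" by (auto simp: u_def divide_simps)
  have M0: "M 0 = 0" using M by (simp add: orlicz_function_def)
  have nn: "0 \<le> M \<bar>t\<bar>" for t using M by (simp add: orlicz_function_def)
  have "ennreal (M \<bar>x n / (\<rho> / u)\<bar>) \<le> ennreal u * ennreal (M \<bar>x n / \<rho>\<bar>)" for n
  proof -
    have "M (u * \<bar>x n / \<rho>\<bar> + (1 - u) * 0) \<le> u * M \<bar>x n / \<rho>\<bar> + (1 - u) * M 0"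
      using u by (intro orlicz_function_convex_comb) auto
    moreover have "\<bar>x n / (\<rho> / u)\<bar> = u * \<bar>x n / \<rho>\<bar>" using u by (simp add: abs_mult)
    ultimately have "M \<bar>x n / (\<rho> / u)\<bar> \<le> u * M \<bar>x n / \<rho>\<bar>"
      by (simp only: M0 mult_zero_right add_0_right)
    then have "ennreal (M \<bar>x n / (\<rho> / u)\<bar>) \<le> ennreal (u * M \<bar>x n / \<rho>\<bar>)" by (rule ennreal_leI)
    then show ?thesis using u(1) nn[of "x n / \<rho>"] by (simp only: ennreal_mult less_imp_le)
  qed
  then have "orlicz_modular M (\<lambda>n. x n / (\<rho> / u)) \<le> (\<Sum>n. ennreal u * ennreal (M \<bar>x n / \<rho>\<bar>))"
    unfolding orlicz_modular_def by (rule suminf_le) auto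
  also have "\<dots> = ennreal u * ennreal K" using K by (simp add: orlicz_modular_def)
  also have "\<dots> \<le> 1" using u K by (simp flip: ennreal_mult)
  finally show thesis using \<rho> u by (intro that[of "\<rho> / u"]) auto
qed

lemma orlicz_dist_less_obtain:
  assumes "x \<in> orlicz_space M" "y \<in> orlicz_space M" "orlicz_dist M x y < r"
  obtains \<rho> where "0 < \<rho>" "\<rho> < r" "orlicz_modular M (\<lambda>n. (x n - y n) / \<rho>) \<le> 1"
proof -
  obtain \<rho> where \<rho>: "0 < \<rho>" "orlicz_modular M (\<lambda>n. x n / \<rho>) \<le> 1"
    using orlicz_space_obtain_le_1 assms by blast
  obtain \<tau> where \<tau>: "0 < \<tau>" "orlicz_modular M (\<lambda>n. y n / \<tau>) \<le> 1"
    using orlicz_space_obtain_le_1 assms by blast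
  have "orlicz_modular M (\<lambda>n. - y n / \<tau>) \<le> 1"
    using \<tau> by (simp add: orlicz_modular_def)
  from orlicz_modular_add_le_1[OF \<rho>(1) \<tau>(1) \<rho>(2) this]
  have "{\<rho>. 0 < \<rho> \<and> orlicz_modular M (\<lambda>n. (x n - y n) / \<rho>) \<le> 1} \<noteq> {}"
    using \<rho>(1) \<tau>(1) by (simp only: add_uminus_conv_diff Collect_empty_eq) (meson add_pos_pos)
  moreover have "Inf {\<rho>. 0 < \<rho> \<and> orlicz_modular M (\<lambda>n. (x n - y n) / \<rho>) \<le> 1} < r"
    using assms by (simp add: orlicz_dist_def orlicz_norm_def)
  ultimately obtain \<rho> where "\<rho> \<in> {\<rho>. 0 < \<rho> \<and> orlicz_modular M (\<lambda>n. (x n - y n) / \<rho>) \<le> 1}" "\<rho> < r"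
    by (elim cInf_lessD[elim_format] bexE)
  then show thesis by (intro that) auto
qed

lemma orlicz_dist_le:
  assumes "0 < \<rho>" "orlicz_modular M (\<lambda>n. (x n - y n) / \<rho>) \<le> 1"
  shows "orlicz_dist M x y \<le> \<rho>"
proof -
  have "orlicz_norm M (\<lambda>n. x n - y n) \<le> \<rho>"
    unfolding orlicz_norm_def
    by (rule cInf_lower) (use assms in \<open>auto intro!: bdd_belowI[of _ 0]\<close>)
  then show ?thesis using assms(1) by (simp add: orlicz_dist_def)
qed

lemma Metric_space_orlicz: "Metric_space (orlicz_space M) (orlicz_dist M)"
proof -
  have nonneg: "0 \<le> orlicz_dist M x y" for x y
  proof (cases "x \<in> orlicz_space M \<and> y \<in> orlicz_space M")
    case True
    show ?thesis
    proof (rule ccontr)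
      assume "\<not> 0 \<le> orlicz_dist M x y"
      then obtain \<rho> :: real where "0 < \<rho>" "\<rho> < 0"
        using orlicz_dist_less_obtain[of x y 0] True by (metis not_le)
      then show False by simp
    qed
  qed (auto simp: orlicz_dist_def)
  have sym: "orlicz_dist M x y = orlicz_dist M y x" for x y
  proof -
    have "\<bar>(x n - y n) / \<rho>\<bar> = \<bar>(y n - x n) / \<rho>\<bar>" for n \<rho>
      by (simp add: abs_minus_commute)
    then show ?thesis
      by (simp only: orlicz_dist_def orlicz_norm_def orlicz_modular_def conj_commute)
  qed
  have zero: "x = y"
    if xy: "x \<in> orlicz_space M" "y \<in> orlicz_space M" "orlicz_dist M x y = 0" for x y
  proof (rule ccontr)
    assume "x \<noteq> y"
    then obtain n where n: "x n \<noteq> y n" by auto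
    have "filterlim M at_top at_top" using M by (simp add: orlicz_function_def)
    then obtain T where T: "\<And>t. t \<ge> T \<Longrightarrow> 1 < M t"
      by (auto simp: filterlim_at_top_dense eventually_at_top_linorder)
    define r where "r = \<bar>x n - y n\<bar> / max 1 T"
    have "orlicz_dist M x y < r" using xy n by (simp add: r_def)
    then obtain \<rho> where \<rho>: "0 < \<rho>" "\<rho> < r" "orlicz_modular M (\<lambda>n. (x n - y n) / \<rho>) \<le> 1"
      using orlicz_dist_less_obtain xy by blast
    have "max 1 T * \<rho> \<le> \<bar>x n - y n\<bar>"
      using \<rho>(2) by (simp add: r_def pos_less_divide_eq mult.commute)
    then have "max 1 T \<le> \<bar>(x n - y n) / \<rho>\<bar>"
      using \<rho>(1) by (simp only: abs_divide abs_of_pos pos_le_divide_eq)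
    then have "1 < M \<bar>(x n - y n) / \<rho>\<bar>" by (intro T) auto
    then have "1 < ennreal (M \<bar>(x n - y n) / \<rho>\<bar>)" by simp
    also have "\<dots> = (\<Sum>k\<in>{n}. ennreal (M \<bar>(x k - y k) / \<rho>\<bar>))" by simp
    also have "\<dots> \<le> orlicz_modular M (\<lambda>n. (x n - y n) / \<rho>)"
      unfolding orlicz_modular_def by (rule sum_le_suminf) auto
    finally show False using \<rho>(3) by simp
  qed
  have refl: "orlicz_dist M x x = 0" for x
  proof -
    have "M 0 = 0" using M by (simp add: orlicz_function_def)
    then have "orlicz_dist M x x \<le> e" if "0 < e" for e
      by (intro orlicz_dist_le that) (simp add: orlicz_modular_def)
    then have "orlicz_dist M x x \<le> 0" by (rule field_le_epsilon) simp
    then show ?thesis using nonneg[of x x] by simp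
  qed
  have triangle: "orlicz_dist M x z \<le> orlicz_dist M x y + orlicz_dist M y z"
    if xyz: "x \<in> orlicz_space M" "y \<in> orlicz_space M" "z \<in> orlicz_space M" for x y z
  proof (rule field_le_epsilon)
    fix e :: real assume "0 < e"
    obtain \<rho> where \<rho>: "0 < \<rho>" "\<rho> < orlicz_dist M x y + e / 2"
        "orlicz_modular M (\<lambda>n. (x n - y n) / \<rho>) \<le> 1"
      using orlicz_dist_less_obtain[of x y "orlicz_dist M x y + e / 2"] xyz \<open>0 < e\<close> by auto
    obtain \<tau> where \<tau>: "0 < \<tau>" "\<tau> < orlicz_dist M y z + e / 2"
        "orlicz_modular M (\<lambda>n. (y n - z n) / \<tau>) \<le> 1"
      using orlicz_dist_less_obtain[of y z "orlicz_dist M y z + e / 2"] xyz \<open>0 < e\<close> by auto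
    have "orlicz_dist M x z \<le> \<rho> + \<tau>"
      using orlicz_modular_add_le_1[OF \<rho>(1) \<tau>(1) \<rho>(3) \<tau>(3)] \<rho>(1) \<tau>(1)
      by (intro orlicz_dist_le) auto
    then show "orlicz_dist M x z \<le> orlicz_dist M x y + orlicz_dist M y z + e"
      using \<rho>(2) \<tau>(2) by simp
  qed
  show ?thesis
  proof
    show "orlicz_dist M x y = 0 \<longleftrightarrow> x = y"
      if "x \<in> orlicz_space M" "y \<in> orlicz_space M" for x y
      using zero that refl by blast
  qed (fact nonneg sym triangle)+
qed

lemma topspace_orlicz_topology: "topspace (orlicz_topology M) = orlicz_space M"
  unfolding orlicz_topology_def by (rule Metric_space.topspace_mtopology[OF Metric_space_orlicz])

end

end

theory Submission
  imports Defs
begin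

text \<open>
  The map \<open>x \<mapsto> (M \<bar>x n\<bar>)\<^sub>n\<close> sends \<open>dom f\<close> to a bounded subset of \<open>\<ell>\<^sub>1\<close>, on which \<open>g\<^sub>a\<close> acts as the linear
  functional \<open>a \<in> \<ell>\<^sub>\<infinity>\<close>. As in Stegall's variational principle, small changes of \<open>a\<close> make the
  \<open>\<ell>\<^sub>1\<close> tails of the near minimizers of \<open>f - g\<^sub>a\<close> arbitrarily small, and this persists on a box
  \<open>[a', a' + s']\<close> of weights; a point common to a nested sequence of boxes has near minimizers with
  uniformly small tails. For such \<open>a\<close> a pointwise convergent minimizing sequence has modular series
  with uniformly small tails, so by \<open>\<Delta>\<^sub>2\<close> it converges in norm, and lower semicontinuity makes the
  limit a minimizer.
\<close>

subsection \<open>Series of sequences with uniformly small tails\<close>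

text \<open>The head is a finite sum and tends to 0 termwise; the tail costs at most
  \<open>e / 2\<close>. Uniformly small tails play the part of the summable majorant in dominated
  convergence.\<close>

lemma tendsto_suminf_0_uniform_tails:
  fixes w :: "nat \<Rightarrow> nat \<Rightarrow> real"
  assumes summable: "\<And>k. summable (w k)" and nonneg: "\<And>k n. 0 \<le> w k n"
    and pointwise: "\<And>n. (\<lambda>k. w k n) \<longlonglongrightarrow> 0"
    and tails: "\<And>e. 0 < e \<Longrightarrow> \<exists>N. \<forall>\<^sub>F k in sequentially. (\<Sum>n. w k (n + N)) \<le> e"
  shows "(\<lambda>k. \<Sum>n. w k n) \<longlonglongrightarrow> 0"
proof (rule tendstoI)
  fix e :: real assume "0 < e"
  then obtain N where N: "\<forall>\<^sub>F k in sequentially. (\<Sum>n. w k (n + N)) \<le> e / 2"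
    using tails[of "e / 2"] by auto
  have "(\<lambda>k. \<Sum>n<N. w k n) \<longlonglongrightarrow> (\<Sum>n<N. 0)"
    by (intro tendsto_sum pointwise)
  then have "\<forall>\<^sub>F k in sequentially. (\<Sum>n<N. w k n) < e / 2"
    using \<open>0 < e\<close> by (intro order_tendstoD(2)) auto
  with N show "\<forall>\<^sub>F k in sequentially. dist (\<Sum>n. w k n) 0 < e"
  proof eventually_elim
    case (elim k)
    have "(\<Sum>n. w k n) < e"
      using elim suminf_split_initial_segment[OF summable, of k N] by simp
    then show ?case using suminf_nonneg[OF summable nonneg, of k] by simp
  qed
qed

text \<open>A Fatou argument: each finite block of the tail passes to the limit, so the partial sums
  of the shifted \<open>v\<close> stay below \<open>e\<close>, which gives summability as
  well.\<close>

lemma pointwise_limit_tail_le: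
  fixes u :: "nat \<Rightarrow> nat \<Rightarrow> real"
  assumes summable: "\<And>k. summable (u k)" and nonneg: "\<And>k n. 0 \<le> u k n"
    and pointwise: "\<And>n. (\<lambda>k. u k n) \<longlonglongrightarrow> v n"
    and le: "\<forall>\<^sub>F k in sequentially. (\<Sum>n. u k (n + N)) \<le> e"
  shows "summable v" "(\<Sum>n. v (n + N)) \<le> e"
proof -
  have v: "0 \<le> v n" for n
    by (rule LIMSEQ_le_const[OF pointwise]) (use nonneg in auto)
  have le_e: "(\<Sum>n<J. v (n + N)) \<le> e" for J
  proof (rule tendsto_upperbound)
    show "(\<lambda>k. \<Sum>n<J. u k (n + N)) \<longlonglongrightarrow> (\<Sum>n<J. v (n + N))"
      by (intro tendsto_sum pointwise)
    show "\<forall>\<^sub>F k in sequentially. (\<Sum>n<J. u k (n + N)) \<le> e"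
      using le
    proof eventually_elim
      case (elim k)
      have "(\<Sum>n<J. u k (n + N)) \<le> (\<Sum>n. u k (n + N))"
        using summable nonneg by (intro sum_le_suminf) (auto simp: summable_iff_shift)
      with elim show ?case by simp
    qed
  qed auto
  then have "summable (\<lambda>n. v (n + N))"
    using v by (intro summableI_nonneg_bounded[of _ e]) auto
  then show "summable v" "(\<Sum>n. v (n + N)) \<le> e"
    using le_e by (auto simp: summable_iff_shift intro: suminf_le_const)
qed

text \<open>The limit inherits the tail bounds, so the majorant \<open>B * (u k n + v n)\<close> of
  the weighted differences has uniformly small tails. This will give convergence of
  \<open>weighted_modular\<close> along the minimizing sequence.\<close>

lemma tendsto_weighted_suminf_uniform_tails:
  fixes u :: "nat \<Rightarrow> nat \<Rightarrow> real"
  assumes summable: "\<And>k. summable (u k)" and nonneg: "\<And>k n. 0 \<le> u k n"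
    and pointwise: "\<And>n. (\<lambda>k. u k n) \<longlonglongrightarrow> v n"
    and tails: "\<And>e. 0 < e \<Longrightarrow> \<exists>N. \<forall>\<^sub>F k in sequentially. (\<Sum>n. u k (n + N)) \<le> e"
    and b: "\<And>n. \<bar>b n\<bar> \<le> B"
  shows "(\<lambda>k. \<Sum>n. b n * u k n) \<longlonglongrightarrow> (\<Sum>n. b n * v n)"
proof -
  have v: "0 \<le> v n" for n
    by (rule LIMSEQ_le_const[OF pointwise]) (use nonneg in auto)
  have B: "0 \<le> B" using b[of 0] by simp
  have diff: "\<bar>u k n - v n\<bar> \<le> u k n + v n" for k n
    using nonneg[of k n] v[of n] by simp
  obtain N0 where "\<forall>\<^sub>F k in sequentially. (\<Sum>n. u k (n + N0)) \<le> 1"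
    using tails[of 1] by auto
  from pointwise_limit_tail_le(1)[OF summable nonneg pointwise this] have sv: "summable v" .
  have sb: "summable (\<lambda>n. b n * z n)" if "summable z" "\<And>n. 0 \<le> z n" for z
    by (rule summable_comparison_test'[OF summable_mult[OF that(1), of B], of 0])
      (use b that(2) in \<open>auto simp: abs_mult intro!: mult_right_mono\<close>)
  have sw: "summable (\<lambda>n. \<bar>b n * (u k n - v n)\<bar>)" for k
    by (rule summable_comparison_test'[OF summable_mult[OF summable_add[OF summable[of k] sv], of B], of 0])
      (use b B diff in \<open>auto simp: abs_mult intro!: mult_mono\<close>)
  have "(\<lambda>k. \<Sum>n. \<bar>b n * (u k n - v n)\<bar>) \<longlonglongrightarrow> 0"
  proof (rule tendsto_suminf_0_uniform_tails[OF sw])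
    show "(\<lambda>k. \<bar>b n * (u k n - v n)\<bar>) \<longlonglongrightarrow> 0" for n
      by (rule tendsto_eq_intros pointwise refl | simp)+
    fix e :: real assume "0 < e"
    \<comment> \<open>The factor 2 pays for the tails of both \<open>u k\<close> and
      \<open>v\<close>; \<open>B + 1\<close> avoids division by zero.\<close>
    define e' where "e' = e / (2 * (B + 1))"
    have e': "0 < e'" "2 * B * e' \<le> e"
      using B \<open>0 < e\<close> by (auto simp: e'_def field_simps)
    obtain N where N: "\<forall>\<^sub>F k in sequentially. (\<Sum>n. u k (n + N)) \<le> e'"
      using tails e'(1) by blast
    note vN = pointwise_limit_tail_le(2)[OF summable nonneg pointwise N]
    from N have "\<forall>\<^sub>F k in sequentially. (\<Sum>n. \<bar>b (n + N) * (u k (n + N) - v (n + N))\<bar>) \<le> e"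
    proof eventually_elim
      case (elim k)
      have s: "summable (\<lambda>n. u k (n + N))" "summable (\<lambda>n. v (n + N))"
        using summable sv by (auto simp: summable_iff_shift)
      have "(\<Sum>n. \<bar>b (n + N) * (u k (n + N) - v (n + N))\<bar>)
          \<le> (\<Sum>n. B * (u k (n + N) + v (n + N)))"
      proof (rule suminf_le)
        show "summable (\<lambda>n. \<bar>b (n + N) * (u k (n + N) - v (n + N))\<bar>)"
          using sw[of k] summable_iff_shift[of "\<lambda>n. \<bar>b n * (u k n - v n)\<bar>" N] by simp
        show "summable (\<lambda>n. B * (u k (n + N) + v (n + N)))"
          by (intro summable_mult summable_add s)
        show "\<bar>b (n + N) * (u k (n + N) - v (n + N))\<bar> \<le> B * (u k (n + N) + v (n + N))" for n
          unfolding abs_mult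
          by (intro mult_mono) (use b B nonneg[of k "n + N"] v[of "n + N"] in auto)
      qed
      also have "\<dots> = B * ((\<Sum>n. u k (n + N)) + (\<Sum>n. v (n + N)))"
        using suminf_mult[OF summable_add[OF s], of B] suminf_add[OF s] by simp
      also have "\<dots> \<le> B * (e' + e')" using elim vN B by (intro mult_left_mono add_mono) auto
      also have "\<dots> \<le> e" using e' by (simp add: algebra_simps)
      finally show ?case .
    qed
    then show "\<exists>N. \<forall>\<^sub>F k in sequentially. (\<Sum>n. \<bar>b (n + N) * (u k (n + N) - v (n + N))\<bar>) \<le> e" ..
  qed auto
  then have "(\<lambda>k. \<Sum>n. b n * (u k n - v n)) \<longlonglongrightarrow> 0"
    by (rule Lim_null_comparison[rotated]) (auto intro!: always_eventually summable_rabs sw)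
  moreover have "(\<Sum>n. b n * (u k n - v n)) = (\<Sum>n. b n * u k n) - (\<Sum>n. b n * v n)" for k
    using sb[OF summable nonneg] sb[OF sv v] by (simp add: right_diff_distrib suminf_diff)
  ultimately show ?thesis by (simp add: LIM_zero_iff)
qed

text \<open>By Tychonoff the cube is compact in the product topology, which is first countable for
  countably many coordinates, so it is sequentially compact.\<close>

lemma bounded_sequences_pointwise_convergent_subsequence:
  fixes X :: "nat \<Rightarrow> nat \<Rightarrow> real"
  assumes "\<And>k n. \<bar>X k n\<bar> \<le> T"
  obtains x and r :: "nat \<Rightarrow> nat"
  where "strict_mono r" "\<And>n. \<bar>x n\<bar> \<le> T" "\<And>n. (\<lambda>k. X (r k) n) \<longlonglongrightarrow> x n"
proof -
  have "compact (UNIV \<rightarrow>\<^sub>E cball 0 T :: (nat \<Rightarrow> real) set)"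
    using compactin_PiE[of "\<lambda>_. euclidean" UNIV "\<lambda>_::nat. cball (0::real) T"]
    by (simp add: euclidean_product_topology)
  then have "seq_compact (UNIV \<rightarrow>\<^sub>E cball 0 T :: (nat \<Rightarrow> real) set)"
    by (rule compact_imp_seq_compact)
  moreover have "\<forall>k. X k \<in> UNIV \<rightarrow>\<^sub>E cball 0 T" using assms by (auto simp: PiE_iff)
  ultimately obtain x r where r: "x \<in> UNIV \<rightarrow>\<^sub>E cball 0 T" "strict_mono r" "(X \<circ> r) \<longlonglongrightarrow> x"
    unfolding seq_compact_def by metis
  show thesis
  proof
    show "strict_mono r" by fact
    show "\<bar>x n\<bar> \<le> T" for n using r(1) by (auto simp: PiE_iff)
    have "isCont (\<lambda>z::nat \<Rightarrow> real. z n) x" for n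
      using continuous_on_product_coordinates[of n]
      by (metis UNIV_I continuous_on_eq_continuous_at open_UNIV)
    from isCont_tendsto_compose[OF this r(3)] show "(\<lambda>k. X (r k) n) \<longlonglongrightarrow> x n" for n
      by (simp add: o_def)
  qed
qed


subsection \<open>Perturbation by linear functionals on a bounded subset of \<open>\<ell>\<^sub>1\<close>\<close>

text \<open>\<open>D\<close> stands for the domain of \<open>f\<close>, \<open>g\<close> for the
  real values of \<open>f\<close> on it, and \<open>m x\<close> for the sequence of the
  \<open>M \<bar>x n\<bar>\<close>, which ranges over a bounded subset of the positive cone of
  l_1.\<close>

locale l1_perturbation =
  fixes D :: "'a set" and g :: "'a \<Rightarrow> real" and m :: "'a \<Rightarrow> nat \<Rightarrow> real" and c R :: real
  assumes D_nonempty: "D \<noteq> {}"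
    and g_ge: "x \<in> D \<Longrightarrow> c \<le> g x"
    and m_nonneg: "x \<in> D \<Longrightarrow> 0 \<le> m x n"
    and m_summable: "x \<in> D \<Longrightarrow> summable (m x)"
    and m_suminf_le: "x \<in> D \<Longrightarrow> (\<Sum>n. m x n) \<le> R"
begin

definition objective :: "(nat \<Rightarrow> real) \<Rightarrow> 'a \<Rightarrow> real" where
  "objective a x = g x - (\<Sum>n. a n * m x n)"

text \<open>Comparing with every competitor avoids the infimum, so that the inequalities of two near
  minimizers can be combined linearly.\<close>

definition near_minimizers :: "(nat \<Rightarrow> real) \<Rightarrow> real \<Rightarrow> 'a set" where
  "near_minimizers a \<eta> = {x \<in> D. \<forall>y\<in>D. objective a x < objective a y + \<eta>}"

text \<open>\<open>N\<close> and \<open>\<eta>\<close> serve all near minimizers at once; this is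
  what gives a minimizing sequence uniformly small tails.\<close>

definition small_tails :: "(nat \<Rightarrow> real) \<Rightarrow> real \<Rightarrow> bool" where
  "small_tails a \<tau> \<longleftrightarrow> (\<exists>N. \<exists>\<eta>>0. \<forall>x\<in>near_minimizers a \<eta>. (\<Sum>n. m x (n + N)) \<le> \<tau>)"

lemma small_tailsE:
  assumes "small_tails a \<tau>"
  obtains N \<eta> where "0 < \<eta>" "\<And>x. x \<in> near_minimizers a \<eta> \<Longrightarrow> (\<Sum>n. m x (n + N)) \<le> \<tau>"
  using assms unfolding small_tails_def by blast

lemma near_minimizers_mono: "\<eta> \<le> \<theta> \<Longrightarrow> near_minimizers a \<eta> \<subseteq> near_minimizers a \<theta>"
  unfolding near_minimizers_def by fastforce

lemma weighted_summable:
  assumes "x \<in> D" "\<And>n. 0 \<le> a n \<and> a n \<le> A"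
  shows "summable (\<lambda>n. a n * m x n)"
  by (rule summable_comparison_test'[OF summable_mult[OF m_summable[OF assms(1)], of A], of 0])
    (use assms m_nonneg in \<open>auto intro!: mult_right_mono\<close>)

lemma R_nonneg: "0 \<le> R"
  using D_nonempty m_suminf_le suminf_nonneg[OF m_summable m_nonneg] by fastforce

lemma objective_ge:
  assumes "x \<in> D" "\<And>n. 0 \<le> a n \<and> a n \<le> A"
  shows "c - A * R \<le> objective a x"
proof -
  have A: "0 \<le> A" using assms(2)[of 0] by simp
  have "(\<Sum>n. a n * m x n) \<le> (\<Sum>n. A * m x n)"
    using assms m_nonneg
    by (intro suminf_le weighted_summable[of x a A] summable_mult m_summable mult_right_mono) auto
  also have "\<dots> = A * (\<Sum>n. m x n)" by (simp add: suminf_mult m_summable assms)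
  also have "\<dots> \<le> A * R" using A assms by (intro mult_left_mono m_suminf_le) auto
  finally show ?thesis using g_ge assms(1) by (force simp: objective_def)
qed

lemma near_minimizers_nonempty:
  assumes "\<And>n. 0 \<le> a n \<and> a n \<le> A" "0 < \<eta>"
  shows "near_minimizers a \<eta> \<noteq> {}"
proof -
  define I where "I = Inf (objective a ` D)"
  have bdd: "bdd_below (objective a ` D)"
    using objective_ge[of _ a A] assms(1) by (intro bdd_belowI2) blast
  have "Inf (objective a ` D) < I + \<eta>" using assms(2) by (simp add: I_def)
  then obtain x where x: "x \<in> D" "objective a x < I + \<eta>"
    using cInf_lessD[of "objective a ` D"] D_nonempty by auto
  moreover have "I \<le> objective a y" if "y \<in> D" for y
    unfolding I_def by (rule cInf_lower) (use bdd that in auto)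
  ultimately have "x \<in> near_minimizers a \<eta>" by (force simp: near_minimizers_def)
  then show ?thesis by blast
qed

text \<open>
  Among the near minimizers for \<open>a\<close>, pick one, \<open>z\<close>, whose \<open>\<ell>\<^sub>1\<close> mass is almost the largest possible,
  and reward the mass on an initial segment carrying almost all of the mass of \<open>z\<close>. Every near
  minimizer for the new weights must then carry almost as much mass as \<open>z\<close> on that segment, so it
  has hardly any mass left for the tail.
\<close>

lemma small_tails_nearby:
  assumes a: "\<And>n. 0 \<le> a n \<and> a n \<le> A" and "0 < s" "0 < \<tau>"
  obtains a' s' where "0 < s'" "\<And>n. a n \<le> a' n" "\<And>n. a' n + s' \<le> a n + s"
    "\<And>b. (\<And>n. a' n \<le> b n \<and> b n \<le> a' n + s') \<Longrightarrow> small_tails b \<tau>"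
proof -
  define S where "S x = (\<Sum>n. m x n)" for x
  \<comment> \<open>Six errors of size \<mu> add up at the end: three from comparing the objectives
    of \<open>x\<close> and \<open>z\<close>, and one each from the choice of \<open>N\<close>, of
    \<open>z\<close> and of \<open>\<eta>0\<close>.\<close>
  define \<mu> where "\<mu> = \<tau> / 6"
  have \<mu>: "0 < \<mu>" "6 * \<mu> = \<tau>" using \<open>0 < \<tau>\<close> by (auto simp: \<mu>_def)
  \<comment> \<open>\<open>L\<close> is the limit, as \<eta> tends to 0, of the supremum of the
    masses \<open>S x\<close> over the \<eta>-near minimizers for \<open>a\<close>.\<close>
  define V where "V = {l. \<exists>\<eta>>0. \<forall>x\<in>near_minimizers a \<eta>. S x \<le> l}"
  define L where "L = Inf V"
  have S_nonneg: "0 \<le> S x" if "x \<in> D" for x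
    unfolding S_def by (rule suminf_nonneg) (use that m_summable m_nonneg in auto)
  have in_D: "x \<in> D" if "x \<in> near_minimizers b \<eta>" for x b \<eta>
    using that by (simp add: near_minimizers_def)
  have "R \<in> V" unfolding V_def using m_suminf_le in_D by (auto simp: S_def intro!: exI[of _ 1])
  have bdd: "bdd_below V"
  proof (rule bdd_belowI)
    fix l assume "l \<in> V"
    then obtain \<eta> where "\<eta> > 0" "\<forall>x\<in>near_minimizers a \<eta>. S x \<le> l" by (auto simp: V_def)
    then show "0 \<le> l"
      using near_minimizers_nonempty[OF a] S_nonneg in_D by (meson ex_in_conv order_trans)
  qed
  have "Inf V < L + \<mu>" using \<mu> by (simp add: L_def)
  then obtain l where l: "l \<in> V" "l < L + \<mu>" using cInf_lessD \<open>R \<in> V\<close> by blast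
  then obtain \<eta>0 where \<eta>0: "0 < \<eta>0" "\<And>x. x \<in> near_minimizers a \<eta>0 \<Longrightarrow> S x \<le> L + \<mu>"
    by (fastforce simp: V_def)
  \<comment> \<open>The reward \<open>t\<close> uses at most half of the room \<open>s\<close> and
    is so small that near minimizers for the new weights remain \<open>\<eta>0\<close>-near
    minimizers for \<open>a\<close>.\<close>
  define t where "t = min (s / 2) (\<eta>0 / (4 * (R + \<mu>)))"
  have "0 < R + \<mu>" using R_nonneg \<mu> by simp
  then have t: "0 < t" "t \<le> s / 2" "t * (R + \<mu>) \<le> \<eta>0 / 4"
  proof -
    show "0 < t" using \<open>0 < R + \<mu>\<close> \<open>0 < s\<close> \<eta>0(1) by (auto simp: t_def)
    show "t \<le> s / 2" unfolding t_def by (rule min.cobounded1)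
    have "t \<le> (\<eta>0 / 4) / (R + \<mu>)" by (simp add: t_def divide_divide_eq_left min.coboundedI2)
    then show "t * (R + \<mu>) \<le> \<eta>0 / 4" using \<open>0 < R + \<mu>\<close> by (simp only: pos_le_divide_eq)
  qed
  have tR: "t * R \<le> \<eta>0 / 4" and t\<mu>: "t * \<mu> \<le> \<eta>0 / 4"
  proof -
    have "0 \<le> t * R" "0 \<le> t * \<mu>" using t(1) R_nonneg \<mu> by auto
    then show "t * R \<le> \<eta>0 / 4" "t * \<mu> \<le> \<eta>0 / 4" using t(3) unfolding distrib_left by linarith+
  qed
  \<comment> \<open>Since \<open>L - \<mu>\<close> is not an upper bound at precision
    \<open>t * \<mu>\<close>, some near minimizer \<open>z\<close> of that precision has larger
    mass.\<close>
  have "L - \<mu> \<notin> V" using cInf_lower[OF _ bdd] \<mu> by (force simp: L_def)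
  then obtain z where z: "z \<in> near_minimizers a (t * \<mu>)" "L - \<mu> < S z"
    using mult_pos_pos[OF t(1) \<mu>(1)] by (auto simp: V_def not_le)
  have zD: "z \<in> D" using z in_D by blast
  define P where "P N x = (\<Sum>n<N. m x n)" for N x
  have "(\<lambda>N. P N z) \<longlonglongrightarrow> S z"
    unfolding P_def S_def by (rule summable_LIMSEQ) (use zD m_summable in auto)
  then have "\<forall>\<^sub>F N in sequentially. S z - \<mu> < P N z"
    using \<mu> by (intro order_tendstoD(1)) auto
  then obtain N where N: "S z - \<mu> < P N z" by (auto simp: eventually_sequentially)
  define a' where "a' n = a n + (if n < N then t else 0)" for n
  \<comment> \<open>Moving the weights within a box of side \<open>s'\<close> changes the objective
    by at most \<open>s' * R\<close>, hence by at most \<open>t * \<mu>\<close>;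
    \<open>R + 1\<close> covers the case \<open>R = 0\<close>.\<close>
  define s' where "s' = min (s / 2) (t * \<mu> / (R + 1))"
  have s': "0 < s'" "s' \<le> s / 2" "s' * R \<le> t * \<mu>"
  proof -
    show "0 < s'" using R_nonneg t \<mu> \<open>0 < s\<close> by (auto simp: s'_def)
    show "s' \<le> s / 2" unfolding s'_def by (rule min.cobounded1)
    have "s' * R \<le> t * \<mu> / (R + 1) * R"
      using R_nonneg by (intro mult_right_mono) (auto simp: s'_def)
    also have "\<dots> \<le> t * \<mu>" using R_nonneg t \<mu> by (simp add: field_simps)
    finally show "s' * R \<le> t * \<mu>" .
  qed
  show thesis
  proof
    show "0 < s'" by fact
    show "a n \<le> a' n" "a' n + s' \<le> a n + s" for n
      using t s' by (auto simp: a'_def)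
    fix b assume b: "\<And>n. a' n \<le> b n \<and> b n \<le> a' n + s'"
    have bA: "0 \<le> b n \<and> b n \<le> A + s" for n
      using a[of n] b[of n] t s' by (auto simp: a'_def split: if_splits)
    have a'A: "0 \<le> a' n \<and> a' n \<le> A + s" for n
      using a[of n] t \<open>0 < s\<close> by (auto simp: a'_def)
    have objective_b: "objective b x \<le> objective a x - t * P N x"
      "objective a x - t * P N x - s' * R \<le> objective b x" if x: "x \<in> D" for x
    proof -
      have fin: "(\<lambda>n. (if n < N then t else 0) * m x n) sums (\<Sum>n<N. t * m x n)"
        using sums_If_finite_set[of "{..<N}" "\<lambda>n. t * m x n"]
        by (simp add: if_distrib[of "\<lambda>u. u * _"] cong: if_cong)
      have "(\<lambda>n. a' n * m x n) sums ((\<Sum>n. a n * m x n) + t * P N x)"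
        using sums_add[OF summable_sums[OF weighted_summable[OF x a]] fin]
        by (simp add: a'_def P_def distrib_right sum_distrib_left)
      then have G: "(\<Sum>n. a' n * m x n) = (\<Sum>n. a n * m x n) + t * P N x"
        by (rule sums_unique[symmetric])
      have "(\<Sum>n. a' n * m x n) \<le> (\<Sum>n. b n * m x n)"
        using b m_nonneg x
        by (intro suminf_le mult_right_mono weighted_summable[OF x bA] weighted_summable[OF x a'A]) auto
      then show "objective b x \<le> objective a x - t * P N x"
        using G by (simp add: objective_def)
      have "(\<Sum>n. b n * m x n) \<le> (\<Sum>n. a' n * m x n + s' * m x n)"
        using b m_nonneg x
        by (intro suminf_le summable_add summable_mult weighted_summable[OF x bA]
            weighted_summable[OF x a'A] m_summable)
          (auto simp flip: distrib_right intro!: mult_right_mono)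
      also have "\<dots> = (\<Sum>n. a' n * m x n) + s' * S x"
        using suminf_add[OF weighted_summable[OF x a'A] summable_mult[OF m_summable[OF x], of s']]
        by (simp add: S_def suminf_mult m_summable x)
      also have "\<dots> \<le> (\<Sum>n. a' n * m x n) + s' * R"
        using s' x m_suminf_le by (simp add: S_def)
      finally show "objective a x - t * P N x - s' * R \<le> objective b x"
        using G by (simp add: objective_def)
    qed
    have P_le_S: "P N x \<le> S x" if "x \<in> D" for x
      unfolding P_def S_def by (rule sum_le_suminf) (use that m_summable m_nonneg in auto)
    have P_nonneg: "0 \<le> P N x" if "x \<in> D" for x
      unfolding P_def by (rule sum_nonneg) (use that m_nonneg in auto)
    have "(\<Sum>n. m x (n + N)) \<le> \<tau>" if x: "x \<in> near_minimizers b (t * \<mu>)" for x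
    proof -
      have xD: "x \<in> D" using x in_D by blast
      have "objective b x < objective b z + t * \<mu>"
        using x zD by (simp add: near_minimizers_def)
      then have *: "objective a x - t * P N x - s' * R < objective a z - t * P N z + t * \<mu>"
        using objective_b(1)[OF zD] objective_b(2)[OF xD] by linarith
      have z': "objective a z < objective a y + t * \<mu>" if "y \<in> D" for y
        using z(1) that by (simp add: near_minimizers_def)
      \<comment> \<open>The errors are \<open>t * \<mu>\<close> for \<open>x\<close>,
        \<open>t * \<mu>\<close> for \<open>z\<close>, and \<open>s' * R\<close> for the box;
        dividing by \<open>t\<close> leaves a loss of mass below \<open>3 * \<mu>\<close>.\<close>
      have "t * P N z < t * P N x + 3 * (t * \<mu>)"
        using * z'[OF xD] s'(3) by linarith
      also have "\<dots> = t * (P N x + 3 * \<mu>)" by (simp add: algebra_simps)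
      finally have P: "P N z < P N x + 3 * \<mu>" using t(1) by simp
      \<comment> \<open>The excess of \<open>x\<close> over any competitor for the old weights is
        below \<open>t * R + 3 * (t * \<mu>)\<close>, four quarters of \<open>\<eta>0\<close>, so
        the upper bound on masses applies to \<open>x\<close>.\<close>
      have "t * P N x \<le> t * R"
        using t(1) P_le_S[OF xD] m_suminf_le[OF xD] by (simp add: S_def)
      moreover have "0 \<le> t * P N z" using t(1) P_nonneg[OF zD] by simp
      ultimately have "objective a x < objective a y + \<eta>0" if "y \<in> D" for y
        using * z'[OF that] s'(3) tR t\<mu> by linarith
      then have "x \<in> near_minimizers a \<eta>0" using xD by (simp add: near_minimizers_def)
      then have "S x \<le> L + \<mu>" by (rule \<eta>0(2))
      moreover have "(\<Sum>n. m x (n + N)) = S x - P N x"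
        unfolding S_def P_def by (rule suminf_minus_initial_segment[OF m_summable[OF xD]])
      ultimately show ?thesis using P N z(2) \<mu> by linarith
    qed
    then show "small_tails b \<tau>"
      unfolding small_tails_def using t(1) \<mu>(1) by (blast intro: mult_pos_pos)
  qed
qed

text \<open>Nested boxes inside the initial one with lower corner \<delta> and side \<epsilon> -
  \<delta>: every weight in the k-th box has small tails at level 1/(k+1), so a common point has
  them at all levels.\<close>

lemma exists_weights_small_tails:
  assumes "0 < \<delta>" "\<delta> < \<epsilon>"
  obtains a where "\<And>n. \<delta> \<le> a n \<and> a n \<le> \<epsilon>" "\<And>\<tau>. 0 < \<tau> \<Longrightarrow> small_tails a \<tau>"
proof -
  \<comment> \<open>A box is coded as the pair of its lower corner and its side length, the latter
    common to all coordinates.\<close>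
  define good where "good k p \<longleftrightarrow> 0 < snd p \<and> (\<forall>n. \<delta> \<le> fst p n \<and> fst p n + snd p \<le> \<epsilon>) \<and>
    (\<forall>b. (\<forall>n. fst p n \<le> b n \<and> b n \<le> fst p n + snd p) \<longrightarrow> small_tails b (inverse (real (Suc k))))"
    for k and p :: "(nat \<Rightarrow> real) \<times> real"
  have step: "\<exists>q. good k q \<and> (\<forall>n. a n \<le> fst q n \<and> fst q n + snd q \<le> a n + s)"
    if p: "0 < s" "\<And>n. \<delta> \<le> a n \<and> a n + s \<le> \<epsilon>" for a s k
  proof -
    have a: "0 \<le> a n \<and> a n \<le> \<epsilon>" for n using p(1) p(2)[of n] assms by auto
    have pos: "0 < inverse (real (Suc k))" by simp
    obtain a' s' where a': "0 < s'" "\<And>n. a n \<le> a' n" "\<And>n. a' n + s' \<le> a n + s"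
      "\<And>b. (\<And>n. a' n \<le> b n \<and> b n \<le> a' n + s') \<Longrightarrow> small_tails b (inverse (real (Suc k)))"
      by (rule small_tails_nearby[of a \<epsilon> s "inverse (real (Suc k))", OF a p(1) pos]) blast
    have "\<delta> \<le> a' n \<and> a' n + s' \<le> \<epsilon>" for n
      using p(2)[of n] a'(2,3)[of n] by linarith
    then show ?thesis using a' by (intro exI[of _ "(a', s')"]) (auto simp: good_def)
  qed
  have "\<exists>p. \<forall>k. good k (p k) \<and> (\<forall>n. fst (p k) n \<le> fst (p (Suc k)) n \<and>
      fst (p (Suc k)) n + snd (p (Suc k)) \<le> fst (p k) n + snd (p k))"
  proof (rule dependent_nat_choice)
    show "\<exists>p. good 0 p" using step[of "\<epsilon> - \<delta>" "\<lambda>_. \<delta>" 0] assms by auto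
    show "\<exists>q. good (Suc k) q \<and> (\<forall>n. fst p n \<le> fst q n \<and> fst q n + snd q \<le> fst p n + snd p)"
      if "good k p" for p k
      using step[of "snd p" "fst p" "Suc k"] that by (auto simp: good_def)
  qed
  then obtain p where good: "\<And>k. good k (p k)"
    and lower: "\<And>k n. fst (p k) n \<le> fst (p (Suc k)) n"
    and upper: "\<And>k n. fst (p (Suc k)) n + snd (p (Suc k)) \<le> fst (p k) n + snd (p k)"
    by blast
  \<comment> \<open>Lower corners increase and upper corners decrease. Comparing both at stage
    \<open>max j k\<close> puts each lower corner below each upper one, so the supremum lies in
    every box.\<close>
  define a where "a n = (SUP k. fst (p k) n)" for n
  have cross: "fst (p j) n \<le> fst (p k) n + snd (p k)" for j k n
  proof -
    have "fst (p j) n \<le> fst (p (max j k)) n"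
      using lift_Suc_mono_le[of "\<lambda>k. fst (p k) n"] lower by simp
    also have "\<dots> \<le> fst (p (max j k)) n + snd (p (max j k))"
      using good by (simp add: good_def less_imp_le)
    also have "\<dots> \<le> fst (p k) n + snd (p k)"
      using lift_Suc_antimono_le[of "\<lambda>k. fst (p k) n + snd (p k)"] upper by simp
    finally show ?thesis .
  qed
  have a: "fst (p k) n \<le> a n \<and> a n \<le> fst (p k) n + snd (p k)" for k n
    unfolding a_def using cross
    by (intro conjI cSUP_upper cSUP_least bdd_aboveI2[of _ _ "fst (p k) n + snd (p k)"]) auto
  show thesis
  proof
    show "\<delta> \<le> a n \<and> a n \<le> \<epsilon>" for n
      using good[of 0] a[of 0 n] unfolding good_def by (meson order_trans)
    fix \<tau> :: real assume "0 < \<tau>"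
    then obtain k where k: "inverse (real (Suc k)) < \<tau>" using reals_Archimedean by blast
    have "small_tails a (inverse (real (Suc k)))" using good[of k] a by (simp add: good_def)
    with k show "small_tails a \<tau>"
      unfolding small_tails_def by (meson less_imp_le order_trans)
  qed
qed

end


subsection \<open>Orlicz functions\<close>

lemma orlicz_function_nonneg: "orlicz_function M \<Longrightarrow> 0 \<le> M \<bar>t\<bar>"
  by (simp add: orlicz_function_def)

lemma orlicz_function_mono: "orlicz_function M \<Longrightarrow> 0 \<le> s \<Longrightarrow> s \<le> t \<Longrightarrow> M s \<le> M t"
  unfolding orlicz_function_def by (auto intro: mono_onD)

lemma orlicz_function_pos: "orlicz_function M \<Longrightarrow> \<not> degenerate M \<Longrightarrow> 0 < t \<Longrightarrow> 0 < M t"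
  unfolding orlicz_function_def degenerate_def
  by (metis less_eq_real_def)

lemma orlicz_function_tendsto:
  assumes "orlicz_function M" "X \<longlonglongrightarrow> x"
  shows "(\<lambda>k. M \<bar>X k\<bar>) \<longlonglongrightarrow> M \<bar>x :: real\<bar>"
proof -
  have "continuous_on {0..} M" using assms(1) by (simp add: orlicz_function_def)
  then show ?thesis
    by (rule continuous_on_tendsto_compose) (use assms(2) in \<open>auto intro: tendsto_rabs\<close>)
qed

lemma orlicz_function_bounded_sublevel:
  assumes "orlicz_function M"
  obtains T where "0 < T" "\<And>t. M \<bar>t\<bar> \<le> r \<Longrightarrow> \<bar>t\<bar> \<le> T"
proof -
  have "filterlim M at_top at_top" using assms by (simp add: orlicz_function_def)
  then obtain T where T: "\<And>t. T \<le> t \<Longrightarrow> r < M t"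
    by (auto simp: filterlim_at_top_dense eventually_at_top_linorder)
  have "\<bar>t\<bar> \<le> max T 1" if "M \<bar>t\<bar> \<le> r" for t
    using T[of "\<bar>t\<bar>"] that by (cases "T \<le> \<bar>t\<bar>") auto
  then show thesis by (intro that[of "max T 1"]) auto
qed

text \<open>The condition at zero controls small \<open>t\<close>; on the remaining part of the
  bounded range, monotonicity and \<open>0 < M r\<close> suffice.\<close>

lemma orlicz_function_doubling:
  assumes M: "orlicz_function M" "\<not> degenerate M" "Delta2_at_zero M"
  obtains C where "0 < C" "\<And>t. 0 \<le> t \<Longrightarrow> t \<le> T \<Longrightarrow> M (2 * t) \<le> C * M t"
proof -
  obtain q where q: "0 < q" "ereal q < Liminf (at_right 0) (\<lambda>t. ereal (M t / M (2 * t)))"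
    using M(3) ereal_dense2[of 0] unfolding Delta2_at_zero_def by (auto simp: zero_ereal_def)
  from less_LiminfD[OF q(2)] obtain r where r: "0 < r" "\<And>t. 0 < t \<Longrightarrow> t < r \<Longrightarrow> q < M t / M (2 * t)"
    by (auto simp: eventually_at_right_field)
  \<comment> \<open>One summand for each range of \<open>t\<close>. The maximum keeps the argument
    of \<open>M\<close> positive even when \<open>T\<close> is negative.\<close>
  define C where "C = 1 / q + M (2 * max T r) / M r"
  have Mr: "0 < M r" using orlicz_function_pos M r(1) by blast
  have M2: "0 \<le> M (2 * max T r)"
    using M(1) r(1) by (auto simp: orlicz_function_def)
  have "M (2 * t) \<le> C * M t" if t: "0 \<le> t" "t \<le> T" for t
  proof -
    have Mt: "0 \<le> M t" using M(1) t by (simp add: orlicz_function_def)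
    consider "t = 0" | "0 < t" "t < r" | "r \<le> t" using t by fastforce
    then show ?thesis
    proof cases
      case 1
      then show ?thesis using M(1) by (simp add: orlicz_function_def)
    next
      case 2
      have "0 < M (2 * t)" using orlicz_function_pos M 2 by simp
      then have "M (2 * t) \<le> 1 / q * M t"
        using r(2)[OF 2] q(1) by (simp add: field_simps)
      also have "\<dots> \<le> C * M t"
        unfolding C_def using Mt Mr M2 by (intro mult_right_mono) auto
      finally show ?thesis .
    next
      case 3
      have "M (2 * t) \<le> M (2 * max T r)" using t by (intro orlicz_function_mono[OF M(1)]) auto
      also have "\<dots> = M (2 * max T r) / M r * M r" using Mr by simp
      also have "\<dots> \<le> M (2 * max T r) / M r * M t"
        using Mr M2 r(1) 3 by (intro mult_left_mono orlicz_function_mono[OF M(1)]) auto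
      also have "\<dots> \<le> C * M t"
        unfolding C_def using Mt q(1) by (intro mult_right_mono) auto
      finally show ?thesis .
    qed
  qed
  moreover have "0 < C" using q Mr M2 by (auto simp: C_def intro: add_pos_nonneg)
  ultimately show thesis using that by blast
qed

text \<open>Doubling is iterated until \<open>2 ^ j\<close> exceeds \<open>K\<close>. The j-th
  doubling takes place on the enlarged range up to \<open>2 ^ j * T\<close>, so its constant depends
  on \<open>j\<close>.\<close>

lemma orlicz_function_dilation:
  assumes M: "orlicz_function M" "\<not> degenerate M" "Delta2_at_zero M" and K: "0 \<le> K"
  obtains C where "0 < C" "\<And>t. 0 \<le> t \<Longrightarrow> t \<le> T \<Longrightarrow> M (K * t) \<le> C * M t"
proof -
  have pow: "\<exists>C>0. \<forall>t. 0 \<le> t \<longrightarrow> t \<le> T \<longrightarrow> M (2 ^ j * t) \<le> C * M t" for j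
  proof (induction j)
    case 0
    show ?case by (intro exI[of _ 1]) simp
  next
    case (Suc j)
    then obtain C where C: "0 < C" "\<And>t. 0 \<le> t \<Longrightarrow> t \<le> T \<Longrightarrow> M (2 ^ j * t) \<le> C * M t" by blast
    obtain C' where C': "0 < C'"
      "\<And>t. 0 \<le> t \<Longrightarrow> t \<le> 2 ^ j * T \<Longrightarrow> M (2 * t) \<le> C' * M t"
      using orlicz_function_doubling[OF M] by blast
    have "M (2 ^ Suc j * t) \<le> C' * C * M t" if t: "0 \<le> t" "t \<le> T" for t
    proof -
      have "M (2 * (2 ^ j * t)) \<le> C' * M (2 ^ j * t)" using t by (intro C'(2)) auto
      also have "\<dots> \<le> C' * (C * M t)" using C'(1) C(2)[OF t] by simp
      finally show ?thesis by (simp add: mult.assoc)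
    qed
    then show ?case using C C' by (intro exI[of _ "C' * C"]) auto
  qed
  obtain j where j: "K < 2 ^ j" using real_arch_pow[of 2 K] by auto
  obtain C where C: "0 < C" "\<And>t. 0 \<le> t \<Longrightarrow> t \<le> T \<Longrightarrow> M (2 ^ j * t) \<le> C * M t"
    using pow by blast
  show thesis
  proof
    fix t assume t: "0 \<le> t" "t \<le> T"
    have "M (K * t) \<le> M (2 ^ j * t)"
      using t j K by (intro orlicz_function_mono[OF M(1)] mult_right_mono) auto
    with C(2)[OF t] show "M (K * t) \<le> C * M t" by simp
  qed (fact C(1))
qed

subsection \<open>Bounded sets and convergence in Orlicz spaces\<close>

lemma orlicz_modular_eq_ennreal:
  assumes "orlicz_function M" "summable (\<lambda>n. M \<bar>x n\<bar>)"
  shows "orlicz_modular M x = ennreal (\<Sum>n. M \<bar>x n\<bar>)"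
  unfolding orlicz_modular_def
  by (rule suminf_ennreal2[OF orlicz_function_nonneg[OF assms(1)] assms(2)])

lemma orlicz_modular_le_1D:
  assumes "orlicz_function M" "orlicz_modular M x \<le> 1"
  shows "summable (\<lambda>n. M \<bar>x n\<bar>)" "(\<Sum>n. M \<bar>x n\<bar>) \<le> 1"
proof -
  show s: "summable (\<lambda>n. M \<bar>x n\<bar>)"
  proof (rule summable_suminf_not_top)
    show "(\<Sum>n. ennreal (M \<bar>x n\<bar>)) \<noteq> top"
      using assms(2) by (auto simp: orlicz_modular_def top_unique)
  qed (rule orlicz_function_nonneg[OF assms(1)])
  have "ennreal (\<Sum>n. M \<bar>x n\<bar>) \<le> ennreal 1"
    using assms(2) unfolding orlicz_modular_eq_ennreal[OF assms(1) s] by simp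
  then show "(\<Sum>n. M \<bar>x n\<bar>) \<le> 1" by (simp only: ennreal_le_iff zero_le_one)
qed

text \<open>Some scaling \<open>x / \<rho>\<close> with \<open>\<rho>\<close> below
  \<open>R + 1\<close> has modular at most 1, which bounds its entries; dilation then carries the
  modular bound over to \<open>x\<close> with a constant independent of \<open>x\<close>.\<close>

lemma orlicz_norm_bounded_imp_modular_bounded:
  assumes M: "orlicz_function M" "\<not> degenerate M" "Delta2_at_zero M"
  obtains T C where
    "\<And>x n. x \<in> orlicz_space M \<Longrightarrow> orlicz_norm M x \<le> R \<Longrightarrow> \<bar>x n\<bar> \<le> T"
    "\<And>x. x \<in> orlicz_space M \<Longrightarrow> orlicz_norm M x \<le> R \<Longrightarrow> summable (\<lambda>n. M \<bar>x n\<bar>)"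
    "\<And>x. x \<in> orlicz_space M \<Longrightarrow> orlicz_norm M x \<le> R \<Longrightarrow> (\<Sum>n. M \<bar>x n\<bar>) \<le> C"
proof -
  obtain T where T: "0 < T" "\<And>t. M \<bar>t\<bar> \<le> 1 \<Longrightarrow> \<bar>t\<bar> \<le> T"
    using orlicz_function_bounded_sublevel[OF M(1)] by blast
  \<comment> \<open>The slack 1 makes room for an admissible \<open>\<rho>\<close> above the
    infimum; the maximum keeps \<open>K\<close> nonnegative for every real \<open>R\<close>.\<close>
  define K where "K = max 0 (R + 1)"
  obtain C where C: "0 < C" "\<And>t. 0 \<le> t \<Longrightarrow> t \<le> T \<Longrightarrow> M (K * t) \<le> C * M t"
    using orlicz_function_dilation[OF M, of K T] by (auto simp: K_def)
  have *: "(\<forall>n. \<bar>x n\<bar> \<le> K * T) \<and> summable (\<lambda>n. M \<bar>x n\<bar>) \<and> (\<Sum>n. M \<bar>x n\<bar>) \<le> C"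
    if x: "x \<in> orlicz_space M" "orlicz_norm M x \<le> R" for x
  proof -
    define V where "V = {\<rho>. 0 < \<rho> \<and> orlicz_modular M (\<lambda>n. x n / \<rho>) \<le> 1}"
    have "V \<noteq> {}" using orlicz_space_obtain_le_1[OF M(1) x(1)] unfolding V_def by blast
    moreover have "Inf V < R + 1" using x(2) by (simp add: orlicz_norm_def V_def)
    ultimately obtain \<rho> where "\<rho> \<in> V" "\<rho> < R + 1" by (elim cInf_lessD[elim_format] bexE)
    then have \<rho>: "0 < \<rho>" "\<rho> \<le> K" "orlicz_modular M (\<lambda>n. x n / \<rho>) \<le> 1"
      by (auto simp: V_def K_def)
    note y = orlicz_modular_le_1D[OF M(1) \<rho>(3)]
    have "M \<bar>x n / \<rho>\<bar> \<le> 1" for n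
      using sum_le_suminf[OF y(1), of "{n}", OF _ orlicz_function_nonneg[OF M(1)]] y(2)
      by (simp del: abs_divide)
    then have xT: "\<bar>x n / \<rho>\<bar> \<le> T" for n using T(2) by blast
    have xK: "\<bar>x n\<bar> \<le> K * \<bar>x n / \<rho>\<bar>" for n
    proof -
      have "\<bar>x n\<bar> = \<rho> * \<bar>x n / \<rho>\<bar>" using \<rho>(1) by simp
      also have "\<dots> \<le> K * \<bar>x n / \<rho>\<bar>" using \<rho>(2) by (intro mult_right_mono) auto
      finally show ?thesis .
    qed
    have "\<bar>x n\<bar> \<le> K * T" for n
      using xK[of n] mult_left_mono[OF xT[of n], of K] by (simp add: K_def)
    moreover have le: "M \<bar>x n\<bar> \<le> C * M \<bar>x n / \<rho>\<bar>" for n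
      using orlicz_function_mono[OF M(1) _ xK[of n]] C(2)[OF _ xT[of n]] by force
    moreover have "summable (\<lambda>n. M \<bar>x n\<bar>)"
      by (rule summable_comparison_test'[OF summable_mult[OF y(1), of C], of 0])
        (use le orlicz_function_nonneg[OF M(1)] in auto)
    moreover have "(\<Sum>n. M \<bar>x n\<bar>) \<le> (\<Sum>n. C * M \<bar>x n / \<rho>\<bar>)"
      using le calculation(3) by (intro suminf_le summable_mult y(1))
    moreover have "(\<Sum>n. C * M \<bar>x n / \<rho>\<bar>) \<le> C"
      using C(1) y by (simp add: suminf_mult del: abs_divide)
    ultimately show ?thesis by (metis order_trans)
  qed
  show thesis by (rule that[of "K * T" C]) (use * in blast)+
qed

text \<open>For fixed \<open>\<rho>\<close> the modular of the difference divided by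
  \<open>\<rho>\<close> tends to 0; once it is below 1, the distance is at most
  \<open>\<rho>\<close>.\<close>

lemma orlicz_dist_tendsto_0:
  fixes X :: "nat \<Rightarrow> nat \<Rightarrow> real"
  assumes M: "orlicz_function M" "\<not> degenerate M" "Delta2_at_zero M"
    and bounded: "\<And>k n. \<bar>X k n\<bar> \<le> T" "\<And>n. \<bar>x n\<bar> \<le> T"
    and pointwise: "\<And>n. (\<lambda>k. X k n) \<longlonglongrightarrow> x n"
    and summable: "\<And>k. summable (\<lambda>n. M \<bar>X k n\<bar>)"
    and tails: "\<And>e. 0 < e \<Longrightarrow> \<exists>N. \<forall>\<^sub>F k in sequentially. (\<Sum>n. M \<bar>X k (n + N)\<bar>) \<le> e"
  shows "x \<in> orlicz_space M" "(\<lambda>k. orlicz_dist M (X k) x) \<longlonglongrightarrow> 0"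
proof -
  note nonneg = orlicz_function_nonneg[OF M(1)]
  note Mlim = orlicz_function_tendsto[OF M(1) pointwise]
  obtain N0 where "\<forall>\<^sub>F k in sequentially. (\<Sum>n. M \<bar>X k (n + N0)\<bar>) \<le> 1"
    using tails[of 1] by auto
  from pointwise_limit_tail_le(1)[OF summable nonneg Mlim this]
  have sx: "summable (\<lambda>n. M \<bar>x n\<bar>)" .
  have "bounded (range x)" using bounded(2) by (auto intro!: boundedI)
  moreover have "orlicz_modular M (\<lambda>n. x n / 1) < \<infinity>"
    using orlicz_modular_eq_ennreal[OF M(1) sx] by simp
  ultimately show "x \<in> orlicz_space M"
    unfolding orlicz_space_def linfty_def using zero_less_one by blast
  show "(\<lambda>k. orlicz_dist M (X k) x) \<longlonglongrightarrow> 0"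
  proof (rule tendstoI)
    fix e :: real assume "0 < e"
    define \<rho> where "\<rho> = e / 2"
    have \<rho>: "0 < \<rho>" using \<open>0 < e\<close> by (simp add: \<rho>_def)
    obtain C where C: "0 < C" "\<And>t. 0 \<le> t \<Longrightarrow> t \<le> T \<Longrightarrow> M (2 / \<rho> * t) \<le> C * M t"
      using orlicz_function_dilation[OF M, of "2 / \<rho>" T] \<rho> by auto
    define w where "w k n = M \<bar>(X k n - x n) / \<rho>\<bar>" for k n
    have w_le: "w k n \<le> C * (M \<bar>X k n\<bar> + M \<bar>x n\<bar>)" for k n
    proof -
      \<comment> \<open>The difference is at most twice the larger entry, and \<open>M\<close> at
        the larger entry is at most the sum of both values. Hence dilation by
        \<open>2 / \<rho>\<close> gives a majorant with uniformly small tails.\<close>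
      define t where "t = max \<bar>X k n\<bar> \<bar>x n\<bar>"
      have "\<bar>X k n - x n\<bar> \<le> 2 * t" by (simp add: t_def)
      then have "\<bar>(X k n - x n) / \<rho>\<bar> \<le> 2 / \<rho> * t"
        using \<rho> by (simp add: divide_right_mono)
      then have "w k n \<le> M (2 / \<rho> * t)"
        unfolding w_def by (intro orlicz_function_mono[OF M(1)]) auto
      also have "\<dots> \<le> C * M t" using bounded by (intro C(2)) (auto simp: t_def)
      also have "\<dots> \<le> C * (M \<bar>X k n\<bar> + M \<bar>x n\<bar>)"
        using C(1) nonneg by (intro mult_left_mono) (auto simp: t_def max_def)
      finally show ?thesis .
    qed
    have sw: "summable (w k)" for k
      by (rule summable_comparison_test'[OF summable_mult[OF summable_add[OF summable[of k] sx], of C], of 0])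
        (use w_le nonneg in \<open>auto simp: w_def simp del: abs_divide\<close>)
    have "(\<lambda>k. \<Sum>n. w k n) \<longlonglongrightarrow> 0"
    proof (rule tendsto_suminf_0_uniform_tails[OF sw])
      show "0 \<le> w k n" for k n unfolding w_def by (rule nonneg)
      show "(\<lambda>k. w k n) \<longlonglongrightarrow> 0" for n
      proof -
        have "(\<lambda>k. (X k n - x n) / \<rho>) \<longlonglongrightarrow> (x n - x n) / \<rho>"
          using \<rho> by (intro tendsto_intros pointwise) auto
        from orlicz_function_tendsto[OF M(1) this] show ?thesis
          using M(1) by (simp add: w_def orlicz_function_def)
      qed
      fix d :: real assume "0 < d"
      then obtain N where N: "\<forall>\<^sub>F k in sequentially. (\<Sum>n. M \<bar>X k (n + N)\<bar>) \<le> d / (2 * C)"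
        using tails[of "d / (2 * C)"] C(1) by auto
      note xN = pointwise_limit_tail_le(2)[OF summable nonneg Mlim N]
      from N have "\<forall>\<^sub>F k in sequentially. (\<Sum>n. w k (n + N)) \<le> d"
      proof eventually_elim
        case (elim k)
        have s: "summable (\<lambda>n. M \<bar>X k (n + N)\<bar>)" "summable (\<lambda>n. M \<bar>x (n + N)\<bar>)"
          "summable (\<lambda>n. w k (n + N))"
          using summable_ignore_initial_segment[OF summable[of k], of N]
            summable_ignore_initial_segment[OF sx, of N]
            summable_ignore_initial_segment[OF sw[of k], of N] by auto
        have "(\<Sum>n. w k (n + N)) \<le> (\<Sum>n. C * (M \<bar>X k (n + N)\<bar> + M \<bar>x (n + N)\<bar>))"
          by (intro suminf_le w_le s summable_mult summable_add)
        also have "\<dots> = C * ((\<Sum>n. M \<bar>X k (n + N)\<bar>) + (\<Sum>n. M \<bar>x (n + N)\<bar>))"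
          using suminf_mult[OF summable_add[OF s(1,2)], of C] suminf_add[OF s(1,2)] by simp
        also have "\<dots> \<le> C * (d / (2 * C) + d / (2 * C))"
          using elim xN C(1) by (intro mult_left_mono add_mono) auto
        also have "\<dots> = d" using C(1) by (simp add: field_simps)
        finally show ?case .
      qed
      then show "\<exists>N. \<forall>\<^sub>F k in sequentially. (\<Sum>n. w k (n + N)) \<le> d" ..
    qed
    then have "\<forall>\<^sub>F k in sequentially. (\<Sum>n. w k n) < 1" by (rule order_tendstoD(2)) simp
    then show "\<forall>\<^sub>F k in sequentially. dist (orlicz_dist M (X k) x) 0 < e"
    proof eventually_elim
      case (elim k)
      have "orlicz_modular M (\<lambda>n. (X k n - x n) / \<rho>) = ennreal (\<Sum>n. w k n)"
        using orlicz_modular_eq_ennreal[OF M(1), of "\<lambda>n. (X k n - x n) / \<rho>"] sw[of k]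
        unfolding w_def .
      also have "\<dots> \<le> 1" using elim by simp
      finally have "orlicz_dist M (X k) x \<le> \<rho>" by (rule orlicz_dist_le[OF M(1) \<rho>])
      moreover have "0 \<le> orlicz_dist M (X k) x"
        by (rule Metric_space.nonneg[OF Metric_space_orlicz[OF M(1)]])
      ultimately show ?case using \<open>0 < e\<close> by (simp add: \<rho>_def)
    qed
  qed
qed

section \<open>Lower semicontinuity along convergent sequences and existence of the
  minimizer\<close>

lemma lower_semicontinuous_map_orlicz_eventually:
  assumes M: "orlicz_function M" and lsc: "lower_semicontinuous_map (orlicz_topology M) f"
    and x: "x \<in> orlicz_space M" "c < f x" and X: "\<And>k. X k \<in> orlicz_space M"
    and lim: "(\<lambda>k. orlicz_dist M (X k) x) \<longlonglongrightarrow> 0"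
  shows "\<forall>\<^sub>F k in sequentially. c < f (X k)"
proof -
  interpret Metric_space "orlicz_space M" "orlicz_dist M" by (rule Metric_space_orlicz[OF M])
  have "openin mtopology {y \<in> orlicz_space M. c < f y}"
    using lsc topspace_orlicz_topology[OF M]
    by (simp add: lower_semicontinuous_map_def orlicz_topology_def)
  then obtain r where r: "0 < r" "mball x r \<subseteq> {y \<in> orlicz_space M. c < f y}"
    using x unfolding openin_mtopology by blast
  have "\<forall>\<^sub>F k in sequentially. orlicz_dist M (X k) x < r"
    using lim r(1) by (rule order_tendstoD(2))
  then show ?thesis
  proof eventually_elim
    case (elim k)
    then have "X k \<in> mball x r" using x(1) X by (simp add: commute)
    then show ?case using r(2) by blast
  qed
qed

theorem theorem4p4:
  fixes M :: "real \<Rightarrow> real" and f :: "(nat \<Rightarrow> real) \<Rightarrow> ereal" and \<delta> \<epsilon> :: real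
  assumes "orlicz_function M" and "\<not> degenerate M" and "Delta2_at_zero M"
    and no_minus_infty: "\<forall>x\<in>orlicz_space M. f x \<noteq> -\<infinity>"
    and proper: "\<exists>x\<in>orlicz_space M. \<bar>f x\<bar> \<noteq> \<infinity>"
    and lsc: "lower_semicontinuous_map (orlicz_topology M) f"
    and bounded_below: "\<exists>c::real. \<forall>x\<in>orlicz_space M. ereal c \<le> f x"
    and bounded_domain: "\<exists>R. \<forall>x\<in>orlicz_space M. f x < \<infinity> \<longrightarrow> orlicz_norm M x \<le> R"
    and "0 < \<delta>" and "\<delta> < \<epsilon>"
  shows "\<exists>a\<in>linfty. (\<forall>n. \<delta> \<le> a n \<and> a n \<le> \<epsilon>) \<and>
           attains_min_on (\<lambda>x. f x - ereal (weighted_modular M a x)) (orlicz_space M)"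
proof -
  note M = assms(1-3)
  define D where "D = {x \<in> orlicz_space M. f x < \<infinity>}"
  \<comment> \<open>\<open>real_of_ereal\<close> sends infinity to 0, so \<open>g\<close> represents
    \<open>f\<close> only on \<open>D\<close>.\<close>
  define g where "g x = real_of_ereal (f x)" for x
  define m where "m x n = M \<bar>x n\<bar>" for x :: "nat \<Rightarrow> real" and n
  obtain c where c: "\<And>x. x \<in> orlicz_space M \<Longrightarrow> ereal c \<le> f x" using bounded_below by blast
  obtain R where R: "\<And>x. x \<in> orlicz_space M \<Longrightarrow> f x < \<infinity> \<Longrightarrow> orlicz_norm M x \<le> R"
    using bounded_domain by blast
  obtain T C where TC:
    "\<And>x n. x \<in> orlicz_space M \<Longrightarrow> orlicz_norm M x \<le> R \<Longrightarrow> \<bar>x n\<bar> \<le> T"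
    "\<And>x. x \<in> orlicz_space M \<Longrightarrow> orlicz_norm M x \<le> R \<Longrightarrow> summable (\<lambda>n. M \<bar>x n\<bar>)"
    "\<And>x. x \<in> orlicz_space M \<Longrightarrow> orlicz_norm M x \<le> R \<Longrightarrow> (\<Sum>n. M \<bar>x n\<bar>) \<le> C"
    using orlicz_norm_bounded_imp_modular_bounded[OF M, of R] by blast
  have fg: "f x = ereal (g x)" if "x \<in> D" for x
    using that no_minus_infty by (auto simp: D_def g_def ereal_real)
  interpret l1_perturbation D g m c C
  proof
    show "D \<noteq> {}" using proper by (force simp: D_def)
    show "c \<le> g x" if "x \<in> D" for x
      using c[of x] fg[OF that] that by (simp add: D_def)
    show "0 \<le> m x n" if "x \<in> D" for x n
      unfolding m_def by (rule orlicz_function_nonneg[OF M(1)])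
    show "summable (m x)" "(\<Sum>n. m x n) \<le> C" if "x \<in> D" for x
      using that R TC unfolding m_def D_def by auto
  qed
  obtain a where a: "\<And>n. \<delta> \<le> a n \<and> a n \<le> \<epsilon>" "\<And>\<tau>. 0 < \<tau> \<Longrightarrow> small_tails a \<tau>"
    using exists_weights_small_tails[OF \<open>0 < \<delta>\<close> \<open>\<delta> < \<epsilon>\<close>] by blast
  have a': "0 \<le> a n \<and> a n \<le> \<epsilon>" for n using a(1)[of n] \<open>0 < \<delta>\<close> by simp
  have "\<exists>z. z \<in> near_minimizers a (inverse (real (Suc k)))" for k
    using near_minimizers_nonempty[of a \<epsilon> "inverse (real (Suc k))"] a' by auto
  then obtain Z where Z: "\<And>k. Z k \<in> near_minimizers a (inverse (real (Suc k)))" by metis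
  then have ZD: "Z k \<in> D" for k by (simp add: near_minimizers_def)
  have ZT: "\<bar>Z k n\<bar> \<le> T" for k n
    using ZD[of k] R TC(1) unfolding D_def by blast
  \<comment> \<open>This limit is only pointwise; the small tails from the choice of
    \<open>a\<close> upgrade it to norm convergence.\<close>
  obtain x r where r: "strict_mono r" and x: "\<And>n. \<bar>x n\<bar> \<le> T" "\<And>n. (\<lambda>k. Z (r k) n) \<longlonglongrightarrow> x n"
    by (rule bounded_sequences_pointwise_convergent_subsequence[of Z T, OF ZT]) blast
  define X where "X k = Z (r k)" for k
  have XD: "X k \<in> D" for k using ZD by (simp add: X_def)
  then have XS: "X k \<in> orlicz_space M" for k by (simp add: D_def)
  have X_near: "\<forall>\<^sub>F k in sequentially. X k \<in> near_minimizers a \<eta>" if \<eta>: "0 < \<eta>" for \<eta>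
  proof -
    obtain j where j: "inverse (real (Suc j)) < \<eta>" using reals_Archimedean[OF \<eta>] by blast
    have "X k \<in> near_minimizers a \<eta>" if "j \<le> k" for k
    proof -
      have "inverse (real (Suc (r k))) \<le> inverse (real (Suc j))"
        using that seq_suble[OF r, of k] by (intro le_imp_inverse_le) auto
      from this less_imp_le[OF j] have "inverse (real (Suc (r k))) \<le> \<eta>" by (rule order_trans)
      from near_minimizers_mono[OF this] show ?thesis using Z unfolding X_def by blast
    qed
    then show ?thesis unfolding eventually_sequentially by blast
  qed
  have X_summable: "summable (\<lambda>n. M \<bar>X k n\<bar>)" for k
    using m_summable[OF XD[of k]] unfolding m_def .
  have X_tails: "\<exists>N. \<forall>\<^sub>F k in sequentially. (\<Sum>n. M \<bar>X k (n + N)\<bar>) \<le> e" if e: "0 < e" for e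
  proof -
    obtain N \<eta> where N: "0 < \<eta>" "\<And>x. x \<in> near_minimizers a \<eta> \<Longrightarrow> (\<Sum>n. m x (n + N)) \<le> e"
      using small_tailsE[OF a(2)[OF e]] by blast
    have "\<forall>\<^sub>F k in sequentially. (\<Sum>n. M \<bar>X k (n + N)\<bar>) \<le> e"
      using X_near[OF N(1)] by eventually_elim (use N(2) in \<open>unfold m_def, blast\<close>)
    then show ?thesis ..
  qed
  have X_lim: "(\<lambda>k. X k n) \<longlonglongrightarrow> x n" for n using x(2) by (simp add: X_def)
  have XT: "\<bar>X k n\<bar> \<le> T" for k n using ZT by (simp add: X_def)
  have x_lim: "x \<in> orlicz_space M" "(\<lambda>k. orlicz_dist M (X k) x) \<longlonglongrightarrow> 0"
    by (rule orlicz_dist_tendsto_0[OF M XT x(1) X_lim X_summable X_tails]; assumption)+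
  have "\<bar>a n\<bar> \<le> \<epsilon>" for n using a'[of n] by simp
  with X_summable orlicz_function_nonneg[OF M(1)] orlicz_function_tendsto[OF M(1) X_lim] X_tails
  have G_lim: "(\<lambda>k. weighted_modular M a (X k)) \<longlonglongrightarrow> weighted_modular M a x"
    unfolding weighted_modular_def by (rule tendsto_weighted_suminf_uniform_tails)
  have obj: "objective a y = g y - weighted_modular M a y" for y
    by (simp add: objective_def weighted_modular_def m_def)
  \<comment> \<open>Finiteness of \<open>f x\<close> is not yet known, so the inequality is stated
    in the extended reals with a real right-hand side; applied to some \<open>y0\<close> in
    \<open>D\<close> it puts \<open>x\<close> into \<open>D\<close>.\<close>
  have min: "f x \<le> ereal (objective a y + weighted_modular M a x)" if y: "y \<in> D" for y
  proof (rule ccontr)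
    assume "\<not> f x \<le> ereal (objective a y + weighted_modular M a x)"
    then have "ereal (objective a y + weighted_modular M a x) < f x" by simp
    from ereal_dense2[OF this] obtain q where q: "objective a y + weighted_modular M a x < q" "ereal q < f x"
      by auto
    \<comment> \<open>Half of the gap is spent on the convergence of
      \<open>weighted_modular\<close>, the other half on near minimality.\<close>
    define d where "d = (q - (objective a y + weighted_modular M a x)) / 2"
    have d: "0 < d" using q(1) by (simp add: d_def)
    have "\<forall>\<^sub>F k in sequentially. weighted_modular M a (X k) < weighted_modular M a x + d"
      using d by (intro order_tendstoD(2)[OF G_lim]) simp
    then have "\<forall>\<^sub>F k in sequentially. False"
      using lower_semicontinuous_map_orlicz_eventually[OF M(1) lsc x_lim(1) q(2) XS x_lim(2)]
        X_near[OF d]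
    proof eventually_elim
      case (elim k)
      from elim(2) have "q < g (X k)" using fg[OF XD[of k]] by simp
      moreover have "objective a (X k) < objective a y + d"
        using elim(3) y by (simp add: near_minimizers_def)
      ultimately show False using elim(1) by (simp add: obj d_def field_simps)
    qed
    then show False by simp
  qed
  obtain y0 where "y0 \<in> D" using D_nonempty by blast
  then have "x \<in> D" using min[of y0] x_lim(1) by (auto simp: D_def)
  have "f x - ereal (weighted_modular M a x) \<le> f y - ereal (weighted_modular M a y)"
    if y: "y \<in> orlicz_space M" for y
  proof (cases "y \<in> D")
    case True
    then show ?thesis using min[OF True] fg[OF True] fg[OF \<open>x \<in> D\<close>] by (simp add: obj)
  next
    \<comment> \<open>Here \<open>f y\<close> is infinite and the subtracted term is real, so the
      right-hand side is infinite.\<close>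
    case False
    then show ?thesis using y by (simp add: D_def)
  qed
  then have "attains_min_on (\<lambda>x. f x - ereal (weighted_modular M a x)) (orlicz_space M)"
    using x_lim(1) by (auto simp: attains_min_on_def)
  moreover have "a \<in> linfty"
    using a' by (auto simp: linfty_def intro!: boundedI[of _ \<epsilon>])
  ultimately show ?thesis using a(1) by blast
qed

end
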